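(* The mapping $\mathrm{qsas2qscs}:\mathrm{QSAS}\to\mathrm{QSCS}$ given, for every $q\in\mathrm{QSAS}$ with domain $\Delta_q$, by $$\mathrm{qsas2qscs}(q)=\mathfrak{F}^{\,2\cdot|\Delta_q|^2}(q)$$ (the $2|\Delta_q|^2$-fold iterate of $\mathfrak{F}$ applied to $q$) is (well-defined and is) the structure closure of $\mathrm{QSAS}$; that is, $\mathrm{QSCS}=\mathrm{QSAS}^{\mathrm{clo}}$ and $\mathrm{qsas2qscs}=\mathrm{clo}_{\mathrm{QSAS}}$.
   Context: A structure is a triple $rs=\langle\Delta,\prec,\sqsubset\rangle$ where $\Delta$ is a finite set (the domain) and $\prec,\sqsubset$ are binary relations over $\Delta$; it is a relational structure if both relations are irreflexive. $rs\trianglelefteq rs'$ ($rs'$ extends $rs$) means that the domains are equal and each relation of $rs$ is included in the corresponding relation of $rs'$. For $x,y\in\Delta$: $rs[x\prec y]=\langle\Delta,\prec\cup\{\langle x,y\rangle\},\sqsubset\rangle$ and $rs[x\sqsubset y]=\langle\Delta,\prec,\sqsubset\cup\{\langle x,y\rangle\}\rangle$. A nonempty $\Phi\subseteq\Delta$ is a csc-subset of $rs$ if the directed graph $\langle\Phi,(\sqsubset\cup\prec)|_{\Phi\times\Phi}\rangle$ is strongly connected. A pre-dominant of $\Phi$ is any $x\in\Phi$ such that there is no $y\in\Phi$ with $x\prec y$ or $y\prec x$. $\mathrm{CSCS}^\dagger(rs)$ is the set of all csc-subsets of $rs$ that have no pre-dominant. $\mathrm{QSAS}$ is the set of all relational structures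 $rs$ with $\mathrm{CSCS}^\dagger(rs)=\varnothing$. $\mathrm{QSAS}^{\max}$ is the set of those $rs\in\mathrm{QSAS}$ whose only extension in $\mathrm{QSAS}$ is $rs$, and $\mathrm{max}_{\mathrm{QSAS}}(rs)=\{rs'\in\mathrm{QSAS}^{\max}\mid rs\trianglelefteq rs'\}$. The structure closure mapping $\mathrm{clo}_{\mathrm{QSAS}}$ is given, for $q\in\mathrm{QSAS}$ with domain $\Delta_q$, by $\mathrm{clo}_{\mathrm{QSAS}}(q)=\big\langle\Delta_q,\ \bigcap\{\prec_m\mid m\in\mathrm{max}_{\mathrm{QSAS}}(q)\},\ \bigcap\{\sqsubset_m\mid m\in\mathrm{max}_{\mathrm{QSAS}}(q)\}\big\rangle$, where $\prec_m,\sqsubset_m$ are the relations of $m$. $q\in\mathrm{QSAS}$ is closed if $q=\mathrm{clo}_{\mathrm{QSAS}}(q)$; $\mathrm{QSAS}^{\mathrm{clo}}$ is the set of all closed $q\in\mathrm{QSAS}$. $\mathrm{QSCS}$ is the set of all structures $q=\langle\Delta,\prec,\sqsubset\rangle$ such that: (1) $x\not\sqsubset x$ and $x\not\prec x$ for all $x\in\Delta$; and for all $x\neq y\in\Delta$: (2) $x\prec y\Rightarrow y\not\sqsubset x$; (3) $\mathrm{CSCS}^\dagger(q[x\prec y])\neq\varnothing\Rightarrow y\sqsubset x$; (4) $\mathrm{CSCS}^\dagger(q[x\sqsubset y])\neq\varnothing\Rightarrow y\prec x$. The function $\mathfrak{F}:\mathrm{QSAS}\to\mathrm{QSAS}$ is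 defined, for $q=\langle\Delta,\prec,\sqsubset\rangle\in\mathrm{QSAS}$, by $\mathfrak{F}(q)=\langle\Delta,\prec\cup\prec',\sqsubset\cup\sqsubset'\rangle$, where $\prec'=\{\langle y,x\rangle\in\Delta\times\Delta\mid x\neq y,\ y\not\prec x,\ \mathrm{CSCS}^\dagger(q[x\sqsubset y])\neq\varnothing\}$ and $\sqsubset'=\{\langle y,x\rangle\in\Delta\times\Delta\mid x\neq y,\ y\not\sqsubset x,\ \mathrm{CSCS}^\dagger(q[x\prec y])\neq\varnothing\}$. *)

theory Defs
  imports "HOL-Library.FuncSet"
begin

record 'a triple =
  sdom :: "'a set"
  sprec :: "'a rel"
  ssqsub :: "'a rel"

definition is_structure :: "'a triple \<Rightarrow> bool" where
  "is_structure s \<longleftrightarrow>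
     finite (sdom s) \<and> sprec s \<subseteq> sdom s \<times> sdom s \<and> ssqsub s \<subseteq> sdom s \<times> sdom s"

definition relational_structure :: "'a triple \<Rightarrow> bool" where
  "relational_structure s \<longleftrightarrow> is_structure s \<and> irrefl (sprec s) \<and> irrefl (ssqsub s)"

definition extended_by :: "'a triple \<Rightarrow> 'a triple \<Rightarrow> bool" (infix "\<unlhd>" 50) where
  "s \<unlhd> s' \<longleftrightarrow> sdom s = sdom s' \<and> sprec s \<subseteq> sprec s' \<and> ssqsub s \<subseteq> ssqsub s'"

definition add_prec :: "'a triple \<Rightarrow> 'a \<Rightarrow> 'a \<Rightarrow> 'a triple" ("_\<lbrakk>_ \<prec> _\<rbrakk>" [1000, 0, 0] 1000) where
  "s\<lbrakk>x \<prec> y\<rbrakk> = s\<lparr>sprec := sprec s \<union> {(x, y)}\<rparr>"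

definition add_sqsub :: "'a triple \<Rightarrow> 'a \<Rightarrow> 'a \<Rightarrow> 'a triple" ("_\<lbrakk>_ \<sqsubset> _\<rbrakk>" [1000, 0, 0] 1000) where
  "s\<lbrakk>x \<sqsubset> y\<rbrakk> = s\<lparr>ssqsub := ssqsub s \<union> {(x, y)}\<rparr>"

text \<open>Strong connectedness is reachability by paths of length at least 0 that stay
  inside the vertex set, so a single vertex is strongly connected.\<close>

definition strongly_connected_digraph :: "'a set \<Rightarrow> 'a rel \<Rightarrow> bool" where
  "strongly_connected_digraph V R \<longleftrightarrow> (\<forall>x\<in>V. \<forall>y\<in>V. (x, y) \<in> (R \<inter> V \<times> V)\<^sup>*)"

definition csc_subset :: "'a triple \<Rightarrow> 'a set \<Rightarrow> bool" where
  "csc_subset s \<Phi> \<longleftrightarrow>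
     \<Phi> \<noteq> {} \<and> \<Phi> \<subseteq> sdom s \<and> strongly_connected_digraph \<Phi> (ssqsub s \<union> sprec s)"

definition pre_dominant :: "'a triple \<Rightarrow> 'a set \<Rightarrow> 'a \<Rightarrow> bool" where
  "pre_dominant s \<Phi> x \<longleftrightarrow>
     x \<in> \<Phi> \<and> \<not> (\<exists>y\<in>\<Phi>. (x, y) \<in> sprec s \<or> (y, x) \<in> sprec s)"

definition CSCS_dagger :: "'a triple \<Rightarrow> 'a set set" where
  "CSCS_dagger s = {\<Phi>. csc_subset s \<Phi> \<and> \<not> (\<exists>x. pre_dominant s \<Phi> x)}"

definition QSAS :: "'a triple set" where
  "QSAS = {s. relational_structure s \<and> CSCS_dagger s = {}}"

definition QSAS_max :: "'a triple set" where
  "QSAS_max = {s \<in> QSAS. \<forall>s'\<in>QSAS. s \<unlhd> s' \<longrightarrow> s' = s}"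

definition max_QSAS :: "'a triple \<Rightarrow> 'a triple set" where
  "max_QSAS s = {s' \<in> QSAS_max. s \<unlhd> s'}"

text \<open>The functions \<open>clo_QSAS\<close>, \<open>frak_F\<close> and \<open>qsas2qscs\<close> below are meant on
  \<open>QSAS\<close> only; outside of it their values are irrelevant.\<close>

definition clo_QSAS :: "'a triple \<Rightarrow> 'a triple" where
  "clo_QSAS q =
     \<lparr>sdom = sdom q,
      sprec = (\<Inter>m\<in>max_QSAS q. sprec m),
      ssqsub = (\<Inter>m\<in>max_QSAS q. ssqsub m)\<rparr>"

definition QSAS_clo :: "'a triple set" where
  "QSAS_clo = {q \<in> QSAS. q = clo_QSAS q}"

definition QSCS :: "'a triple set" where
  "QSCS = {q. is_structure q \<and>
     (\<forall>x\<in>sdom q. (x, x) \<notin> ssqsub q \<and> (x, x) \<notin> sprec q) \<and>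
     (\<forall>x\<in>sdom q. \<forall>y\<in>sdom q. x \<noteq> y \<longrightarrow>
        ((x, y) \<in> sprec q \<longrightarrow> (y, x) \<notin> ssqsub q) \<and>
        (CSCS_dagger (q\<lbrakk>x \<prec> y\<rbrakk>) \<noteq> {} \<longrightarrow> (y, x) \<in> ssqsub q) \<and>
        (CSCS_dagger (q\<lbrakk>x \<sqsubset> y\<rbrakk>) \<noteq> {} \<longrightarrow> (y, x) \<in> sprec q))}"

definition frak_F :: "'a triple \<Rightarrow> 'a triple" where
  "frak_F q =
     \<lparr>sdom = sdom q,
      sprec = sprec q \<union>
        {(y, x) \<in> sdom q \<times> sdom q. x \<noteq> y \<and> (y, x) \<notin> sprec q \<and> CSCS_dagger (q\<lbrakk>x \<sqsubset> y\<rbrakk>) \<noteq> {}},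
      ssqsub = ssqsub q \<union>
        {(y, x) \<in> sdom q \<times> sdom q. x \<noteq> y \<and> (y, x) \<notin> ssqsub q \<and> CSCS_dagger (q\<lbrakk>x \<prec> y\<rbrakk>) \<noteq> {}}\<rparr>"

definition qsas2qscs :: "'a triple \<Rightarrow> 'a triple" where
  "qsas2qscs q = (frak_F ^^ (2 * (card (sdom q))\<^sup>2)) q"

end

(* Everything rests on one exchange property: for q in QSAS and x \<noteq> y, at least one of
   q[x \<prec> y] and q[y \<sqsubset> x] is again in QSAS. Indeed, if A and B are offending csc-subsets of
   these two structures, then A \<union> B is already a csc-subset of q, since a path of A from y to x
   need not use the new edge x \<rightarrow> y, and symmetrically for B. A pre-dominant of A \<union> B in q cannot
   lie in B, hence is a pre-dominant of A in q destroyed by x \<prec> y, i.e. it is x or y; but both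
   belong to B.
   As QSAS is closed downwards, every maximal extension of q therefore contains all pairs that
   \<FF> adds to q, so \<FF> stays in QSAS and preserves the set of maximal extensions. Its
   fixed points are the elements of QSCS; by the exchange property they are closed. *)

theory Submission imports Defs begin

section \<open>Adding single pairs and the extension order\<close>

lemma add_prec_simps [simp]:
  "sdom (s\<lbrakk>x \<prec> y\<rbrakk>) = sdom s"
  "sprec (s\<lbrakk>x \<prec> y\<rbrakk>) = insert (x, y) (sprec s)"
  "ssqsub (s\<lbrakk>x \<prec> y\<rbrakk>) = ssqsub s"
  by (auto simp: add_prec_def)

lemma add_sqsub_simps [simp]:
  "sdom (s\<lbrakk>x \<sqsubset> y\<rbrakk>) = sdom s"
  "sprec (s\<lbrakk>x \<sqsubset> y\<rbrakk>) = sprec s"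
  "ssqsub (s\<lbrakk>x \<sqsubset> y\<rbrakk>) = insert (x, y) (ssqsub s)"
  by (auto simp: add_sqsub_def)

lemma extended_by_refl [simp]: "s \<unlhd> s"
  by (simp add: extended_by_def)

lemma extended_by_trans [trans]: "s \<unlhd> t \<Longrightarrow> t \<unlhd> u \<Longrightarrow> s \<unlhd> u"
  by (auto simp: extended_by_def)

lemma extended_by_antisym: "s \<unlhd> t \<Longrightarrow> t \<unlhd> s \<Longrightarrow> s = (t :: 'a triple)"
  by (auto simp: extended_by_def)

lemma extended_by_add_prec: "s \<unlhd> s\<lbrakk>x \<prec> y\<rbrakk>"
  by (auto simp: extended_by_def)

lemma extended_by_add_sqsub: "s \<unlhd> s\<lbrakk>x \<sqsubset> y\<rbrakk>"
  by (auto simp: extended_by_def)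

lemma extended_by_frak_F: "q \<unlhd> frak_F q"
  by (auto simp: extended_by_def frak_F_def)

section \<open>Strong connectedness up to one extra edge\<close>

text \<open>Every use of the edge (a, b) on a path in \<open>V\<close> can be replaced by a detour
  in \<open>S\<close>. The detour may leave \<open>V\<close>: in the union argument it runs through
  the other set.\<close>

lemma strongly_connected_insert_path:
  assumes "strongly_connected_digraph V (insert (a, b) R)" "R \<inter> V \<times> V \<subseteq> S"
    and "(a, b) \<in> S\<^sup>*" "u \<in> V" "v \<in> V"
  shows "(u, v) \<in> S\<^sup>*"
proof -
  have "(u, v) \<in> (insert (a, b) R \<inter> V \<times> V)\<^sup>*"
    using assms by (auto simp: strongly_connected_digraph_def)
  moreover have "insert (a, b) R \<inter> V \<times> V \<subseteq> S\<^sup>*"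
    using assms by auto
  ultimately show ?thesis
    by (metis rtrancl_mono rtrancl_idemp subsetD)
qed

text \<open>A path from b to a can be stopped at its first visit to a, hence before it could use the
  edge (a, b).\<close>

lemma strongly_connected_insert_back:
  assumes "strongly_connected_digraph V (insert (a, b) R)" "a \<in> V" "b \<in> V"
  shows "(b, a) \<in> (R \<inter> V \<times> V)\<^sup>*"
proof -
  have "(b, a) \<in> (insert (a, b) (R \<inter> V \<times> V))\<^sup>*"
    using assms by (auto simp: strongly_connected_digraph_def)
  then show ?thesis
    by (auto simp: rtrancl_insert)
qed

text \<open>Each set supplies the detour that the other lacks: inside \<open>V\<close> there is an
  old path from b to a, inside \<open>W\<close> one from a to b. With both extra edges replaced,
  every vertex is linked to a in both directions.\<close>

lemma strongly_connected_Un: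
  assumes V: "strongly_connected_digraph V (insert (a, b) R)"
    and W: "strongly_connected_digraph W (insert (b, a) R)"
    and ab: "a \<in> V" "b \<in> V" "a \<in> W" "b \<in> W"
  shows "strongly_connected_digraph (V \<union> W) R"
proof -
  define S where "S = R \<inter> (V \<union> W) \<times> (V \<union> W)"
  have sub: "R \<inter> V \<times> V \<subseteq> S" "R \<inter> W \<times> W \<subseteq> S"
    by (auto simp: S_def)
  have "(b, a) \<in> S\<^sup>*" "(a, b) \<in> S\<^sup>*"
    using strongly_connected_insert_back[OF V] strongly_connected_insert_back[OF W] ab
      rtrancl_mono[OF sub(1)] rtrancl_mono[OF sub(2)] by blast+
  then have "(u, a) \<in> S\<^sup>*" "(a, u) \<in> S\<^sup>*" if "u \<in> V \<union> W" for u
    using that ab strongly_connected_insert_path[OF V sub(1)]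
      strongly_connected_insert_path[OF W sub(2)] by blast+
  then show ?thesis
    unfolding strongly_connected_digraph_def S_def[symmetric]
    by (meson rtrancl_trans)
qed

section \<open>Monotonicity in the relations\<close>

lemma strongly_connected_mono:
  assumes "strongly_connected_digraph V R" "R \<subseteq> S"
  shows "strongly_connected_digraph V S"
proof -
  have "(R \<inter> V \<times> V)\<^sup>* \<subseteq> (S \<inter> V \<times> V)\<^sup>*"
    using assms(2) by (intro rtrancl_mono) auto
  then show ?thesis
    using assms(1) by (auto simp: strongly_connected_digraph_def)
qed

lemma csc_subset_mono: "csc_subset s A \<Longrightarrow> s \<unlhd> t \<Longrightarrow> csc_subset t A"
  by (auto simp: csc_subset_def extended_by_def elim!: strongly_connected_mono)

lemma pre_dominant_antimono: "pre_dominant t A x \<Longrightarrow> s \<unlhd> t \<Longrightarrow> pre_dominant s A x"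
  by (auto simp: pre_dominant_def extended_by_def)

text \<open>More pairs preserve strong connectedness and can only destroy pre-dominants, so an
  offending set stays offending. This is what makes \<open>QSAS\<close> closed downwards.\<close>

lemma CSCS_dagger_mono: "s \<unlhd> t \<Longrightarrow> CSCS_dagger s \<subseteq> CSCS_dagger t"
  by (auto simp: CSCS_dagger_def intro: csc_subset_mono pre_dominant_antimono)

lemma QSAS_downward: "t \<in> QSAS \<Longrightarrow> s \<unlhd> t \<Longrightarrow> s \<in> QSAS"
  using CSCS_dagger_mono[of s t]
  by (auto simp: QSAS_def relational_structure_def is_structure_def extended_by_def irrefl_def)

lemma QSAS_add_prec_iff:
  assumes "q \<in> QSAS" "x \<in> sdom q" "y \<in> sdom q" "x \<noteq> y"
  shows "q\<lbrakk>x \<prec> y\<rbrakk> \<in> QSAS \<longleftrightarrow> CSCS_dagger (q\<lbrakk>x \<prec> y\<rbrakk>) = {}"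
  using assms by (auto simp: QSAS_def relational_structure_def is_structure_def irrefl_def)

lemma QSAS_add_sqsub_iff:
  assumes "q \<in> QSAS" "x \<in> sdom q" "y \<in> sdom q" "x \<noteq> y"
  shows "q\<lbrakk>x \<sqsubset> y\<rbrakk> \<in> QSAS \<longleftrightarrow> CSCS_dagger (q\<lbrakk>x \<sqsubset> y\<rbrakk>) = {}"
  using assms by (auto simp: QSAS_def relational_structure_def is_structure_def irrefl_def)

section \<open>The exchange property and incompatible pairs\<close>

text \<open>If an endpoint of the new pair lay outside \<open>A\<close>, the pair would be invisible
  inside \<open>A\<close>, which would then offend in \<open>q\<close> already. The inclusions on
  \<open>t\<close> fit both x \<prec> y and x \<sqsubset> y as the added pair.\<close>

lemma CSCS_dagger_new_edge:
  assumes q: "CSCS_dagger q = {}" and A: "A \<in> CSCS_dagger t"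
    and t: "sdom t = sdom q" "ssqsub t \<union> sprec t \<subseteq> insert (x, y) (ssqsub q \<union> sprec q)"
      "sprec q \<subseteq> sprec t" "sprec t \<subseteq> insert (x, y) (sprec q)"
  shows "x \<in> A \<and> y \<in> A"
proof (rule ccontr)
  assume nin: "\<not> (x \<in> A \<and> y \<in> A)"
  have "(ssqsub t \<union> sprec t) \<inter> A \<times> A \<subseteq> (ssqsub q \<union> sprec q) \<inter> A \<times> A"
    using t nin by auto
  then have "((ssqsub t \<union> sprec t) \<inter> A \<times> A)\<^sup>* \<subseteq> ((ssqsub q \<union> sprec q) \<inter> A \<times> A)\<^sup>*"
    by (rule rtrancl_mono)
  then have "strongly_connected_digraph A (ssqsub q \<union> sprec q)"
    using A unfolding CSCS_dagger_def csc_subset_def strongly_connected_digraph_def by blast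
  then have "csc_subset q A"
    using A t(1) by (auto simp: CSCS_dagger_def csc_subset_def)
  moreover have "pre_dominant t A z" if "pre_dominant q A z" for z
    using that t(4) nin by (auto simp: pre_dominant_def)
  ultimately have "A \<in> CSCS_dagger q"
    using A by (auto simp: CSCS_dagger_def)
  with q show False by simp
qed

lemma QSAS_exchange:
  assumes q: "q \<in> QSAS" and "x \<in> sdom q" "y \<in> sdom q" "x \<noteq> y"
  shows "CSCS_dagger (q\<lbrakk>x \<prec> y\<rbrakk>) = {} \<or> CSCS_dagger (q\<lbrakk>y \<sqsubset> x\<rbrakk>) = {}"
proof (rule ccontr)
  assume "\<not> ?thesis"
  then obtain A B where A: "A \<in> CSCS_dagger (q\<lbrakk>x \<prec> y\<rbrakk>)" and B: "B \<in> CSCS_dagger (q\<lbrakk>y \<sqsubset> x\<rbrakk>)"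
    by blast
  have q': "CSCS_dagger q = {}"
    using q by (simp add: QSAS_def)
  have xyA: "x \<in> A" "y \<in> A"
    using CSCS_dagger_new_edge[OF q' A, of x y] by auto
  have xyB: "x \<in> B" "y \<in> B"
    using CSCS_dagger_new_edge[OF q' B, of y x] by auto
  have "strongly_connected_digraph A (insert (x, y) (ssqsub q \<union> sprec q))"
    and "strongly_connected_digraph B (insert (y, x) (ssqsub q \<union> sprec q))"
    using A B by (auto simp: CSCS_dagger_def csc_subset_def)
  then have "strongly_connected_digraph (A \<union> B) (ssqsub q \<union> sprec q)"
    using strongly_connected_Un xyA xyB by metis
  then have "csc_subset q (A \<union> B)"
    using A B by (auto simp: CSCS_dagger_def csc_subset_def)
  then obtain z where z: "pre_dominant q (A \<union> B) z"
    using q' by (auto simp: CSCS_dagger_def)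
  \<comment> \<open>Adding y \<sqsubset> x leaves \<prec> unchanged, so a pre-dominant of the union
    lying in \<open>B\<close> would also be a pre-dominant of \<open>B\<close> in the enlarged
    structure.\<close>
  have "z \<notin> B"
    using z B by (auto simp: CSCS_dagger_def pre_dominant_def)
  then have "pre_dominant (q\<lbrakk>x \<prec> y\<rbrakk>) A z"
    using z xyB by (auto simp: pre_dominant_def)
  with A show False
    by (auto simp: CSCS_dagger_def)
qed

text \<open>Together x \<prec> y and y \<sqsubset> x make {x, y} strongly connected, while x \<prec>
  y alone deprives both elements of pre-dominance.\<close>

lemma QSAS_prec_not_sqsub:
  assumes "q \<in> QSAS" "(x, y) \<in> sprec q"
  shows "(y, x) \<notin> ssqsub q"
proof
  assume yx: "(y, x) \<in> ssqsub q"
  have xy: "x \<in> sdom q" "y \<in> sdom q"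
    using assms by (auto simp: QSAS_def relational_structure_def is_structure_def)
  have "strongly_connected_digraph {x, y} (ssqsub q \<union> sprec q)"
    using assms(2) yx by (auto simp: strongly_connected_digraph_def)
  with xy assms(2) have "{x, y} \<in> CSCS_dagger q"
    by (auto simp: CSCS_dagger_def csc_subset_def pre_dominant_def)
  with assms(1) show False
    by (simp add: QSAS_def)
qed

section \<open>Counting pairs and the existence of maximal extensions\<close>

text \<open>A measure that grows strictly along proper extensions and is bounded in terms of the
  domain. It yields maximal extensions as well as the number of iterations after which
  \<open>frak_F\<close> has stabilised.\<close>

definition num_pairs :: "'a triple \<Rightarrow> nat" where
  "num_pairs s = card (sprec s) + card (ssqsub s)"

lemma is_structure_finite:
  assumes "is_structure s"
  shows "finite (sprec s)" "finite (ssqsub s)"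
  using assms by (auto simp: is_structure_def intro: finite_subset)

lemma num_pairs_le:
  assumes "is_structure s"
  shows "num_pairs s \<le> 2 * (card (sdom s))\<^sup>2"
proof -
  have "card R \<le> card (sdom s \<times> sdom s)" if "R \<subseteq> sdom s \<times> sdom s" for R
    using assms that by (intro card_mono) (auto simp: is_structure_def)
  then have "card (sprec s) \<le> card (sdom s \<times> sdom s)" "card (ssqsub s) \<le> card (sdom s \<times> sdom s)"
    using assms by (simp_all only: is_structure_def)
  then show ?thesis
    by (simp add: num_pairs_def card_cartesian_product power2_eq_square)
qed

lemma num_pairs_less:
  assumes "is_structure t" "s \<unlhd> t" "s \<noteq> t"
  shows "num_pairs s < num_pairs (t :: 'a triple)"
proof -
  note fin = is_structure_finite[OF assms(1)]
  have "sprec s \<subset> sprec t \<or> ssqsub s \<subset> ssqsub t"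
    using assms by (auto simp: extended_by_def)
  then show ?thesis
    using psubset_card_mono[OF fin(1)] psubset_card_mono[OF fin(2)] assms(2)
      card_mono[OF fin(1)] card_mono[OF fin(2)]
    unfolding num_pairs_def extended_by_def by (meson add_le_less_mono add_less_le_mono)
qed

lemma max_QSAS_D:
  assumes "m \<in> max_QSAS q"
  shows "m \<in> QSAS" "q \<unlhd> m"
  using assms by (simp_all add: max_QSAS_def QSAS_max_def)

lemma QSAS_is_structure: "q \<in> QSAS \<Longrightarrow> is_structure q"
  by (simp add: QSAS_def relational_structure_def)

text \<open>An extension in \<open>QSAS\<close> with the largest number of pairs is maximal.
  Consequently the intersections in \<open>clo_QSAS\<close> range over a nonempty family for
  \<open>q\<close> in \<open>QSAS\<close>.\<close>

lemma max_QSAS_nonempty: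
  assumes "q \<in> QSAS"
  obtains m where "m \<in> max_QSAS q"
proof -
  define P where "P t \<longleftrightarrow> t \<in> QSAS \<and> q \<unlhd> t" for t
  have "P q" using assms by (simp add: P_def)
  \<comment> \<open>All extensions of \<open>q\<close> share its domain, so one bound serves for all
    of them.\<close>
  moreover have "\<forall>t. P t \<longrightarrow> num_pairs t < Suc (2 * (card (sdom q))\<^sup>2)"
    unfolding P_def by (metis QSAS_is_structure extended_by_def less_Suc_eq_le num_pairs_le)
  ultimately obtain m where m: "P m" "\<And>t. P t \<Longrightarrow> num_pairs t \<le> num_pairs m"
    using ex_has_greatest_nat[of P q num_pairs] by blast
  have "t = m" if "t \<in> QSAS" "m \<unlhd> t" for t
  proof (rule ccontr)
    assume "t \<noteq> m"
    then have "num_pairs m < num_pairs t"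
      using that num_pairs_less QSAS_is_structure by metis
    moreover have "P t"
      using that m(1) extended_by_trans unfolding P_def by blast
    ultimately show False
      using m(2) by fastforce
  qed
  then have "m \<in> max_QSAS q"
    using m(1) by (simp add: P_def max_QSAS_def QSAS_max_def)
  then show thesis by (rule that)
qed

lemma max_QSAS_mono: "s \<unlhd> t \<Longrightarrow> max_QSAS t \<subseteq> max_QSAS s"
  by (auto simp: max_QSAS_def intro: extended_by_trans)

section \<open>Maximal extensions absorb the pairs added by \<open>frak_F\<close>\<close>

text \<open>By exchange one of the two pairs can be added without leaving \<open>QSAS\<close>; by
  maximality that pair is already present.\<close>

lemma QSAS_max_prec_or_sqsub:
  assumes m: "m \<in> QSAS_max" and xy: "x \<in> sdom m" "y \<in> sdom m" "x \<noteq> y"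
  shows "(x, y) \<in> sprec m \<or> (y, x) \<in> ssqsub m"
proof -
  have mQ: "m \<in> QSAS" and max: "\<And>t. t \<in> QSAS \<Longrightarrow> m \<unlhd> t \<Longrightarrow> t = m"
    using m by (simp_all add: QSAS_max_def)
  from QSAS_exchange[OF mQ xy] show ?thesis
  proof
    assume "CSCS_dagger (m\<lbrakk>x \<prec> y\<rbrakk>) = {}"
    then have "m\<lbrakk>x \<prec> y\<rbrakk> = m"
      using QSAS_add_prec_iff[OF mQ xy] max[OF _ extended_by_add_prec] by simp
    from arg_cong[OF this, of sprec] show ?thesis
      by auto
  next
    assume "CSCS_dagger (m\<lbrakk>y \<sqsubset> x\<rbrakk>) = {}"
    then have "m\<lbrakk>y \<sqsubset> x\<rbrakk> = m"
      using QSAS_add_sqsub_iff[OF mQ xy(2,1)] xy(3) max[OF _ extended_by_add_sqsub] by simp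
    from arg_cong[OF this, of ssqsub] show ?thesis
      by auto
  qed
qed

text \<open>A pair is added to one relation only if its converse in the other relation creates an
  offending set in \<open>q\<close>. By monotonicity that converse is then absent from
  \<open>m\<close>, and the dichotomy for maximal structures forces the added pair into
  \<open>m\<close>.\<close>

lemma frak_F_extended_by_max:
  assumes "m \<in> max_QSAS q"
  shows "frak_F q \<unlhd> m"
proof -
  have m: "m \<in> QSAS_max" "q \<unlhd> m"
    using assms by (simp_all add: max_QSAS_def)
  have empty: "CSCS_dagger m = {}"
    using max_QSAS_D(1)[OF assms] by (simp add: QSAS_def)
  have dom: "sdom m = sdom q"
    using m by (simp add: extended_by_def)
  have "(y, x) \<in> sprec m"
    if "x \<in> sdom q" "y \<in> sdom q" "x \<noteq> y" "CSCS_dagger (q\<lbrakk>x \<sqsubset> y\<rbrakk>) \<noteq> {}" for x y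
  proof -
    have "\<not> q\<lbrakk>x \<sqsubset> y\<rbrakk> \<unlhd> m"
    proof
      assume "q\<lbrakk>x \<sqsubset> y\<rbrakk> \<unlhd> m"
      from CSCS_dagger_mono[OF this] show False
        using empty that(4) by simp
    qed
    then have "(x, y) \<notin> ssqsub m"
      using m(2) by (simp add: extended_by_def)
    then show ?thesis
      using QSAS_max_prec_or_sqsub[OF m(1), of y x] that dom by simp
  qed
  moreover have "(y, x) \<in> ssqsub m"
    if "x \<in> sdom q" "y \<in> sdom q" "x \<noteq> y" "CSCS_dagger (q\<lbrakk>x \<prec> y\<rbrakk>) \<noteq> {}" for x y
  proof -
    have "\<not> q\<lbrakk>x \<prec> y\<rbrakk> \<unlhd> m"
    proof
      assume "q\<lbrakk>x \<prec> y\<rbrakk> \<unlhd> m"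
      from CSCS_dagger_mono[OF this] show False
        using empty that(4) by simp
    qed
    then have "(x, y) \<notin> sprec m"
      using m(2) by (simp add: extended_by_def)
    then show ?thesis
      using QSAS_max_prec_or_sqsub[OF m(1), of x y] that dom by simp
  qed
  ultimately show ?thesis
    using m(2) unfolding frak_F_def extended_by_def by (simp add: subset_iff)
qed

lemma frak_F_in_QSAS:
  assumes "q \<in> QSAS"
  shows "frak_F q \<in> QSAS"
proof -
  obtain m where m: "m \<in> max_QSAS q"
    using max_QSAS_nonempty[OF assms] .
  show ?thesis
    by (rule QSAS_downward[OF max_QSAS_D(1)[OF m] frak_F_extended_by_max[OF m]])
qed

lemma sdom_frak_F: "sdom (frak_F q) = sdom q"
  by (simp add: frak_F_def)

lemma max_QSAS_frak_F: "max_QSAS (frak_F q) = max_QSAS q"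
proof
  show "max_QSAS (frak_F q) \<subseteq> max_QSAS q"
    by (rule max_QSAS_mono[OF extended_by_frak_F])
  show "max_QSAS q \<subseteq> max_QSAS (frak_F q)"
  proof
    fix m assume m: "m \<in> max_QSAS q"
    then show "m \<in> max_QSAS (frak_F q)"
      using frak_F_extended_by_max[OF m] by (simp add: max_QSAS_def)
  qed
qed

lemma clo_QSAS_frak_F: "clo_QSAS (frak_F q) = clo_QSAS q"
  unfolding clo_QSAS_def max_QSAS_frak_F sdom_frak_F ..

text \<open>This encloses \<open>frak_F q\<close> between \<open>q\<close> and its closure, so that
  a closed structure must be a fixed point.\<close>

lemma frak_F_extended_by_clo: "frak_F q \<unlhd> clo_QSAS q"
proof -
  have "sprec (frak_F q) \<subseteq> sprec m" "ssqsub (frak_F q) \<subseteq> ssqsub m" if "m \<in> max_QSAS q" for m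
    using frak_F_extended_by_max[OF that] by (simp_all only: extended_by_def)
  then show ?thesis
    unfolding extended_by_def clo_QSAS_def by (simp add: le_INF_iff sdom_frak_F)
qed

section \<open>Fixed points, \<open>QSCS\<close> and closed structures\<close>

text \<open>The pairs that \<open>frak_F\<close> adds are exactly those demanded by (3) and (4) and
  still missing; (2) and irreflexivity come from \<open>QSAS\<close>.\<close>

lemma frak_F_fixed_in_QSCS:
  assumes q: "q \<in> QSAS" and fixed: "frak_F q = q"
  shows "q \<in> QSCS"
proof -
  have "(y, x) \<in> sprec q"
    if "x \<in> sdom q" "y \<in> sdom q" "x \<noteq> y" "CSCS_dagger (q\<lbrakk>x \<sqsubset> y\<rbrakk>) \<noteq> {}" for x y
  proof -
    have "(y, x) \<in> sprec (frak_F q)"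
      using that by (auto simp: frak_F_def)
    then show ?thesis by (simp add: fixed)
  qed
  moreover have "(y, x) \<in> ssqsub q"
    if "x \<in> sdom q" "y \<in> sdom q" "x \<noteq> y" "CSCS_dagger (q\<lbrakk>x \<prec> y\<rbrakk>) \<noteq> {}" for x y
  proof -
    have "(y, x) \<in> ssqsub (frak_F q)"
      using that by (auto simp: frak_F_def)
    then show ?thesis by (simp add: fixed)
  qed
  ultimately show ?thesis
    using q QSAS_prec_not_sqsub[OF q]
    by (auto simp: QSCS_def QSAS_def relational_structure_def irrefl_def)
qed

lemma QSCS_D:
  assumes "q \<in> QSCS" "x \<in> sdom q" "y \<in> sdom q" "x \<noteq> y"
  shows "(x, y) \<in> sprec q \<Longrightarrow> (y, x) \<notin> ssqsub q"
    and "CSCS_dagger (q\<lbrakk>x \<prec> y\<rbrakk>) \<noteq> {} \<Longrightarrow> (y, x) \<in> ssqsub q"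
    and "CSCS_dagger (q\<lbrakk>x \<sqsubset> y\<rbrakk>) \<noteq> {} \<Longrightarrow> (y, x) \<in> sprec q"
  using assms unfolding QSCS_def by blast+

(* An offending csc-subset survives every further pair, so conditions (3) and (4) would force
   both relations to hold between any two of its elements, against (2). *)
lemma QSCS_subset_QSAS: "QSCS \<subseteq> QSAS"
proof
  fix q :: "'a triple"
  assume q: "q \<in> QSCS"
  have "A \<notin> CSCS_dagger q" for A
  proof
    assume A: "A \<in> CSCS_dagger q"
    then obtain x where x: "x \<in> A" "A \<subseteq> sdom q"
      by (auto simp: CSCS_dagger_def csc_subset_def)
    then obtain y where y: "y \<in> A" "(x, y) \<in> sprec q \<or> (y, x) \<in> sprec q"
      using A by (auto simp: CSCS_dagger_def pre_dominant_def)
    with q x have "x \<noteq> y" "x \<in> sdom q" "y \<in> sdom q"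
      by (auto simp: QSCS_def)
    moreover have "CSCS_dagger (q\<lbrakk>u \<prec> v\<rbrakk>) \<noteq> {}" "CSCS_dagger (q\<lbrakk>u \<sqsubset> v\<rbrakk>) \<noteq> {}" for u v
      using A CSCS_dagger_mono[OF extended_by_add_prec, of q u v]
        CSCS_dagger_mono[OF extended_by_add_sqsub, of q u v] by blast+
    ultimately show False
      using QSCS_D[OF q] by metis
  qed
  then show "q \<in> QSAS"
    using q by (auto simp: QSAS_def QSCS_def relational_structure_def irrefl_def is_structure_def)
qed

text \<open>Suppose a pair of the closure is missing from \<open>q\<close>. By (3) or (4) its
  converse in the other relation can be added within \<open>QSAS\<close>. A maximal extension of the
  result is also one of \<open>q\<close>, so it contains both pairs, which are incompatible.\<close>

lemma QSCS_clo_QSAS: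
  assumes q: "q \<in> QSCS"
  shows "clo_QSAS q = q"
proof (rule extended_by_antisym)
  have qQ: "q \<in> QSAS"
    using q QSCS_subset_QSAS by blast
  show "q \<unlhd> clo_QSAS q"
    by (rule extended_by_trans[OF extended_by_frak_F frak_F_extended_by_clo])
  \<comment> \<open>A single maximal extension suffices to see that the pairs of the closure lie in
    the domain and off the diagonal.\<close>
  obtain m0 where m0: "m0 \<in> max_QSAS q"
    using max_QSAS_nonempty[OF qQ] .
  have in_dom: "x \<in> sdom q" "y \<in> sdom q" "x \<noteq> y"
    if "(x, y) \<in> sprec m0 \<union> ssqsub m0" for x y
    using that max_QSAS_D[OF m0]
    by (auto simp: QSAS_def relational_structure_def is_structure_def irrefl_def extended_by_def)
  have "(x, y) \<in> sprec q" if xy: "(x, y) \<in> sprec (clo_QSAS q)" for x y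
  proof (rule ccontr)
    have all: "(x, y) \<in> sprec m" if "m \<in> max_QSAS q" for m
      using xy that by (auto simp: clo_QSAS_def)
    assume "(x, y) \<notin> sprec q"
    then have ext: "q\<lbrakk>y \<sqsubset> x\<rbrakk> \<in> QSAS"
      using QSCS_D(3)[OF q] in_dom all[OF m0] QSAS_add_sqsub_iff[OF qQ] by (metis UnI1)
    obtain m where m: "m \<in> max_QSAS (q\<lbrakk>y \<sqsubset> x\<rbrakk>)"
      using max_QSAS_nonempty[OF ext] .
    then have "(x, y) \<in> sprec m"
      by (rule all[OF subsetD[OF max_QSAS_mono[OF extended_by_add_sqsub]]])
    moreover have "(y, x) \<in> ssqsub m" "m \<in> QSAS"
      using max_QSAS_D[OF m] by (simp_all add: extended_by_def)
    ultimately show False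
      using QSAS_prec_not_sqsub[of m x y] by simp
  qed
  moreover have "(x, y) \<in> ssqsub q" if xy: "(x, y) \<in> ssqsub (clo_QSAS q)" for x y
  proof (rule ccontr)
    have all: "(x, y) \<in> ssqsub m" if "m \<in> max_QSAS q" for m
      using xy that by (auto simp: clo_QSAS_def)
    assume "(x, y) \<notin> ssqsub q"
    then have ext: "q\<lbrakk>y \<prec> x\<rbrakk> \<in> QSAS"
      using QSCS_D(2)[OF q] in_dom all[OF m0] QSAS_add_prec_iff[OF qQ] by (metis UnI2)
    obtain m where m: "m \<in> max_QSAS (q\<lbrakk>y \<prec> x\<rbrakk>)"
      using max_QSAS_nonempty[OF ext] .
    then have "(x, y) \<in> ssqsub m"
      by (rule all[OF subsetD[OF max_QSAS_mono[OF extended_by_add_prec]]])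
    moreover have "(y, x) \<in> sprec m" "m \<in> QSAS"
      using max_QSAS_D[OF m] by (simp_all add: extended_by_def)
    ultimately show False
      using QSAS_prec_not_sqsub[of m y x] by simp
  qed
  moreover have "sdom (clo_QSAS q) = sdom q"
    by (simp add: clo_QSAS_def)
  ultimately show "clo_QSAS q \<unlhd> q"
    unfolding extended_by_def by (simp add: subrelI)
qed

lemma QSCS_eq_QSAS_clo: "(QSCS :: 'a triple set) = QSAS_clo"
proof
  show "(QSCS :: 'a triple set) \<subseteq> QSAS_clo"
  proof
    fix q :: "'a triple"
    assume "q \<in> QSCS"
    then show "q \<in> QSAS_clo"
      using subsetD[OF QSCS_subset_QSAS, of q] by (simp add: QSAS_clo_def QSCS_clo_QSAS)
  qed
  show "QSAS_clo \<subseteq> (QSCS :: 'a triple set)"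
  proof
    fix q :: "'a triple"
    assume "q \<in> QSAS_clo"
    then have q: "q \<in> QSAS" "clo_QSAS q = q"
      by (simp_all add: QSAS_clo_def)
    \<comment> \<open>Here q \<unlhd> \<open>frak_F q\<close> \<unlhd> \<open>clo_QSAS q\<close> =
      q.\<close>
    then have "frak_F q = q"
      using frak_F_extended_by_clo[of q] extended_by_antisym[OF _ extended_by_frak_F, of q] by simp
    with q(1) show "q \<in> QSCS"
      by (rule frak_F_fixed_in_QSCS)
  qed
qed

section \<open>Iterating \<open>frak_F\<close> up to stabilisation\<close>

lemma frak_F_funpow_in_QSAS: "q \<in> QSAS \<Longrightarrow> (frak_F ^^ k) q \<in> QSAS"
  by (induction k) (simp_all add: frak_F_in_QSAS)

lemma sdom_frak_F_funpow: "sdom ((frak_F ^^ k) q) = sdom q"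
  by (induction k) (simp_all add: sdom_frak_F)

lemma clo_QSAS_frak_F_funpow: "clo_QSAS ((frak_F ^^ k) q) = clo_QSAS q"
  by (induction k) (simp_all add: clo_QSAS_frak_F)

lemma frak_F_num_pairs:
  assumes "q \<in> QSAS" "frak_F q \<noteq> q"
  shows "num_pairs q < num_pairs (frak_F q)"
  using num_pairs_less[OF QSAS_is_structure[OF frak_F_in_QSAS] extended_by_frak_F, of q] assms
  by simp

text \<open>Each step before stabilisation contributes at least one new pair, and a fixed point,
  once reached, is kept.\<close>

lemma frak_F_funpow_fixed_or_num_pairs:
  assumes "q \<in> QSAS"
  shows "frak_F ((frak_F ^^ k) q) = (frak_F ^^ k) q \<or> k \<le> num_pairs ((frak_F ^^ k) q)"
proof (induction k)
  case (Suc k)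
  then show ?case
    using frak_F_num_pairs[OF frak_F_funpow_in_QSAS[OF assms, of k]]
    by (cases "frak_F ((frak_F ^^ k) q) = (frak_F ^^ k) q") auto
qed simp

lemma qsas2qscs_fixed:
  assumes "q \<in> QSAS"
  shows "frak_F (qsas2qscs q) = qsas2qscs q"
proof (rule ccontr)
  let ?N = "2 * (card (sdom q))\<^sup>2"
  let ?r = "(frak_F ^^ ?N) q"
  assume "\<not> ?thesis"
  then have ne: "frak_F ?r \<noteq> ?r"
    by (simp add: qsas2qscs_def)
  have r: "?r \<in> QSAS" "sdom (frak_F ?r) = sdom q"
    using assms by (simp_all add: frak_F_funpow_in_QSAS sdom_frak_F sdom_frak_F_funpow)
  \<comment> \<open>Without stabilisation \<open>?r\<close> has at least \<open>?N\<close> pairs and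
    one further step adds another, but two relations on the domain hold at most \<open>?N\<close>
    pairs in total.\<close>
  have "?N < num_pairs (frak_F ?r)"
    using frak_F_funpow_fixed_or_num_pairs[OF assms, of ?N] ne frak_F_num_pairs[OF r(1) ne]
    by linarith
  moreover have "num_pairs (frak_F ?r) \<le> ?N"
    using num_pairs_le[OF QSAS_is_structure[OF frak_F_in_QSAS[OF r(1)]]] r(2) by simp
  ultimately show False by simp
qed

lemma qsas2qscs_in_QSCS: "q \<in> QSAS \<Longrightarrow> qsas2qscs q \<in> QSCS"
  by (rule frak_F_fixed_in_QSCS[OF _ qsas2qscs_fixed]) (simp_all add: qsas2qscs_def frak_F_funpow_in_QSAS)

text \<open>The iterate lies in \<open>QSCS\<close>, so it equals its own closure, and iterating
  \<open>frak_F\<close> does not change the closure.\<close>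

lemma qsas2qscs_eq_clo_QSAS: "q \<in> QSAS \<Longrightarrow> qsas2qscs q = clo_QSAS q"
  using QSCS_clo_QSAS[OF qsas2qscs_in_QSCS, of q] by (simp add: qsas2qscs_def clo_QSAS_frak_F_funpow)

theorem theorem7p7:
  shows "(frak_F :: 'a triple \<Rightarrow> 'a triple) \<in> QSAS \<rightarrow> QSAS \<and>
    (qsas2qscs :: 'a triple \<Rightarrow> 'a triple) \<in> QSAS \<rightarrow> QSCS \<and>
    (QSCS :: 'a triple set) = QSAS_clo \<and>
    (\<forall>q \<in> (QSAS :: 'a triple set). qsas2qscs q = clo_QSAS q)"
  by (simp add: frak_F_in_QSAS qsas2qscs_in_QSCS QSCS_eq_QSAS_clo [symmetric]
      qsas2qscs_eq_clo_QSAS [symmetric])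

end
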